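(* Let $(X,r)$ be a nondegenerate quadratic set ($X$ not necessarily finite) and let $(X,f)$ be the associated nondegenerate quadratic set with $$f:X\times X\to X\times X,\qquad f(x,y)=({}^xy,x).$$ Let $\tau(x,y)=(y,x)$. Then: (1) $r=f\circ\tau\circ f^{-1}$ if and only if $r$ is involutive and satisfies lri; equivalently, if and only if $r$ is involutive and cyclic. (2) Suppose $r$ satisfies lri. Then any two of the following conditions imply the third, and also imply that $r=f\circ\tau\circ f^{-1}$ (equivalently, that $r$ is involutive and satisfies lri; equivalently, that $r$ is involutive and cyclic): (a) ${}^{(x^y)}z={}^xz$ for all $x,y,z\in X$; (b) $f$ obeys the Yang–Baxter equation; (c) $r$ obeys the Yang–Baxter equation. (3) Suppose $r$ is square-free. Then the following hold simultaneously: $r$ satisfies lri, $r=f\circ\tau\circ f^{-1}$ (equivalently, $r$ is involutive and satisfies lri; equivalently, $r$ is involutive and cyclic), ${}^{(x^y)}z={}^xz$ for all $x,y,z\in X$, $f$ obeys the Yang–Baxter equation, and $r$ obeys the Yang–Baxter equation, if and only if $(X,r)$ is a symmetric set of multipermutation level $\le 2$.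
   Context: A quadratic set $(X,r)$ is a nonempty set $X$ with a bijection $r:X\times X\to X\times X$, written $r(x,y)=({}^xy,x^y)$; put $\mathcal L_x(y)={}^xy$, $\mathcal R_y(x)=x^y$. It is nondegenerate if all $\mathcal L_x,\mathcal R_x$ are bijective; square-free if $r(x,x)=(x,x)$ for all $x$; involutive if $r^2=\mathrm{id}$. A map $s:X\times X\to X\times X$ obeys the Yang–Baxter equation if $s^{12}s^{23}s^{12}=s^{23}s^{12}s^{23}$ on $X^3$, where $s^{12}=s\times\mathrm{id}$, $s^{23}=\mathrm{id}\times s$. A symmetric set is an involutive quadratic set obeying the Yang–Baxter equation. Condition lri: $({}^xy)^x=y={}^x(y^x)$ for all $x,y\in X$. $(X,r)$ is cyclic if for all $x,y\in X$: ${}^{(y^x)}x={}^yx$, ${}^{({}^xy)}x={}^yx$, $x^{({}^xy)}=x^y$, and $x^{(y^x)}=x^y$. For a nondegenerate symmetric set, $x\sim y$ iff $\mathcal L_x=\mathcal L_y$; $\mathrm{Ret}(X,r)$ is $X/\!\sim$ with the (well-defined) induced nondegenerate symmetric set structure $([x],[y])\mapsto([{}^xy],[x^y])$. The multipermutation level is the minimal $m\ge0$ (if any) such that $\mathrm{Ret}^m(X,r)$ is a one-element set. *)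

theory Defs
  imports Main "HOL-Library.Disjoint_Sets"
begin

text \<open>
  A quadratic set is a carrier \<open>X\<close> together with a map \<open>r\<close> on pairs, of which only the values on
  \<open>X \<times> X\<close> matter. For \<open>r (x, y) = (\<^sup>xy, x\<^sup>y)\<close>, the first component is \<open>lact r x y\<close> and the
  second one is \<open>ract r x y\<close>; thus \<open>lact r x\<close> is the left action of \<open>x\<close>, and
  \<open>\<lambda>x. ract r x y\<close> is the right action of \<open>y\<close>.
\<close>

type_synonym 'a qset = "'a set \<times> ('a \<times> 'a \<Rightarrow> 'a \<times> 'a)"

definition lact :: "('a \<times> 'a \<Rightarrow> 'a \<times> 'a) \<Rightarrow> 'a \<Rightarrow> 'a \<Rightarrow> 'a" where
  "lact r x y = fst (r (x, y))"

definition ract :: "('a \<times> 'a \<Rightarrow> 'a \<times> 'a) \<Rightarrow> 'a \<Rightarrow> 'a \<Rightarrow> 'a" where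
  "ract r x y = snd (r (x, y))"

definition quadratic_set :: "'a set \<Rightarrow> ('a \<times> 'a \<Rightarrow> 'a \<times> 'a) \<Rightarrow> bool" where
  "quadratic_set X r \<longleftrightarrow> X \<noteq> {} \<and> bij_betw r (X \<times> X) (X \<times> X)"

definition nondegenerate :: "'a set \<Rightarrow> ('a \<times> 'a \<Rightarrow> 'a \<times> 'a) \<Rightarrow> bool" where
  "nondegenerate X r \<longleftrightarrow>
     (\<forall>x\<in>X. bij_betw (\<lambda>y. lact r x y) X X) \<and> (\<forall>y\<in>X. bij_betw (\<lambda>x. ract r x y) X X)"

definition square_free :: "'a set \<Rightarrow> ('a \<times> 'a \<Rightarrow> 'a \<times> 'a) \<Rightarrow> bool" where
  "square_free X r \<longleftrightarrow> (\<forall>x\<in>X. r (x, x) = (x, x))"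

definition involutive :: "'a set \<Rightarrow> ('a \<times> 'a \<Rightarrow> 'a \<times> 'a) \<Rightarrow> bool" where
  "involutive X r \<longleftrightarrow> (\<forall>p\<in>X \<times> X. r (r p) = p)"

definition on12 :: "('a \<times> 'a \<Rightarrow> 'a \<times> 'a) \<Rightarrow> 'a \<times> 'a \<times> 'a \<Rightarrow> 'a \<times> 'a \<times> 'a" where
  "on12 s = (\<lambda>(x, y, z). case s (x, y) of (x', y') \<Rightarrow> (x', y', z))"

definition on23 :: "('a \<times> 'a \<Rightarrow> 'a \<times> 'a) \<Rightarrow> 'a \<times> 'a \<times> 'a \<Rightarrow> 'a \<times> 'a \<times> 'a" where
  "on23 s = map_prod id s"

definition yang_baxter :: "'a set \<Rightarrow> ('a \<times> 'a \<Rightarrow> 'a \<times> 'a) \<Rightarrow> bool" where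
  "yang_baxter X s \<longleftrightarrow>
     (\<forall>t\<in>X \<times> X \<times> X. on12 s (on23 s (on12 s t)) = on23 s (on12 s (on23 s t)))"

definition symmetric_set :: "'a set \<Rightarrow> ('a \<times> 'a \<Rightarrow> 'a \<times> 'a) \<Rightarrow> bool" where
  "symmetric_set X r \<longleftrightarrow> quadratic_set X r \<and> involutive X r \<and> yang_baxter X r"

definition lri :: "'a set \<Rightarrow> ('a \<times> 'a \<Rightarrow> 'a \<times> 'a) \<Rightarrow> bool" where
  "lri X r \<longleftrightarrow> (\<forall>x\<in>X. \<forall>y\<in>X. ract r (lact r x y) x = y \<and> y = lact r x (ract r y x))"

definition cyclic :: "'a set \<Rightarrow> ('a \<times> 'a \<Rightarrow> 'a \<times> 'a) \<Rightarrow> bool" where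
  "cyclic X r \<longleftrightarrow> (\<forall>x\<in>X. \<forall>y\<in>X.
     lact r (ract r y x) x = lact r y x \<and>
     lact r (lact r x y) x = lact r y x \<and>
     ract r x (lact r x y) = ract r x y \<and>
     ract r x (ract r y x) = ract r x y)"

definition assoc_map :: "('a \<times> 'a \<Rightarrow> 'a \<times> 'a) \<Rightarrow> 'a \<times> 'a \<Rightarrow> 'a \<times> 'a" where
  "assoc_map r = (\<lambda>(x, y). (lact r x y, x))"

text \<open>
  \<open>r = f \<circ> \<tau> \<circ> f\<^sup>-\<^sup>1\<close> as maps on \<open>X \<times> X\<close>, where \<open>f = assoc_map r\<close> and \<open>\<tau>\<close> is the flip.
\<close>

definition flip_conjugate :: "'a set \<Rightarrow> ('a \<times> 'a \<Rightarrow> 'a \<times> 'a) \<Rightarrow> bool" where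
  "flip_conjugate X r \<longleftrightarrow>
     (\<forall>p\<in>X \<times> X. r p = (assoc_map r \<circ> prod.swap \<circ> inv_into (X \<times> X) (assoc_map r)) p)"

definition lact_ract_invariant :: "'a set \<Rightarrow> ('a \<times> 'a \<Rightarrow> 'a \<times> 'a) \<Rightarrow> bool" where
  "lact_ract_invariant X r \<longleftrightarrow> (\<forall>x\<in>X. \<forall>y\<in>X. \<forall>z\<in>X. lact r (ract r x y) z = lact r x z)"

definition ret_rel :: "'a set \<Rightarrow> ('a \<times> 'a \<Rightarrow> 'a \<times> 'a) \<Rightarrow> ('a \<times> 'a) set" where
  "ret_rel X r = {(x, y) \<in> X \<times> X. \<forall>z\<in>X. lact r x z = lact r y z}"

text \<open>
  The induced map is computed on chosen representatives; by \<open>Ret_apply\<close> below, the choice is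
  irrelevant for nondegenerate symmetric sets.
\<close>

definition Ret :: "'a qset \<Rightarrow> 'a set qset" where
  "Ret = (\<lambda>(X, r). (X // ret_rel X r,
     \<lambda>(A, B). let x = SOME x. x \<in> A; y = SOME y. y \<in> B
              in (ret_rel X r `` {lact r x y}, ret_rel X r `` {ract r x y})))"

definition transport :: "('a \<Rightarrow> 'b) \<Rightarrow> 'a qset \<Rightarrow> 'b qset" where
  "transport h = (\<lambda>(Y, s). (h ` Y, map_prod h h \<circ> s \<circ> map_prod (inv_into Y h) (inv_into Y h)))"

text \<open>
  Since \<open>Ret\<close> changes the type of the elements, its iterates are represented uniformly on sets of
  elements of the original carrier: an element of the \<open>m\<close>-th retraction is given by its fibre under
  the canonical projection from the original set. Concretely, start with singletons and, after each
  retraction, replace each class of fibres by its union. By \<open>inj_on_Union_Ret_pow\<close> this is just a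
  renaming of elements.
\<close>

primrec Ret_pow :: "'a qset \<Rightarrow> nat \<Rightarrow> 'a set qset" where
  "Ret_pow Q 0 = transport (\<lambda>x. {x}) Q"
| "Ret_pow Q (Suc m) = transport Union (Ret (Ret_pow Q m))"

definition has_multipermutation_level :: "'a set \<Rightarrow> ('a \<times> 'a \<Rightarrow> 'a \<times> 'a) \<Rightarrow> nat \<Rightarrow> bool" where
  "has_multipermutation_level X r m \<longleftrightarrow>
     is_singleton (fst (Ret_pow (X, r) m)) \<and> (\<forall>k<m. \<not> is_singleton (fst (Ret_pow (X, r) k)))"

lemma equiv_ret_rel: "equiv X (ret_rel X r)"
  by (rule equivI) (auto simp: ret_rel_def refl_on_def sym_def trans_def)

lemma fst_Ret: "fst (Ret Q) = fst Q // ret_rel (fst Q) (snd Q)"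
  by (simp add: Ret_def split: prod.split)

lemma fst_transport: "fst (transport h Q) = h ` fst Q"
  by (simp add: transport_def split: prod.split)

lemma inj_on_Union_quotient:
  assumes P: "partition_on X P" and E: "equiv P E"
  shows "inj_on Union (P // E)"
proof (rule inj_onI)
  have sub: "C \<subseteq> D" if "C \<in> P // E" "D \<in> P // E" "\<Union>C = \<Union>D" for C D
  proof
    fix A assume A: "A \<in> C"
    with that E have AP: "A \<in> P" by (meson in_quotient_imp_subset subsetD)
    with P obtain a where a: "a \<in> A" by (metis all_not_in_conv partition_onD3)
    with A that obtain B where B: "B \<in> D" "a \<in> B" by blast
    with that E have "B \<in> P" by (meson in_quotient_imp_subset subsetD)
    with AP P a B have "A = B" by (auto simp: partition_on_def disjoint_def)
    with B show "A \<in> D" by simp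
  qed
  fix C D assume "C \<in> P // E" "D \<in> P // E" "\<Union>C = \<Union>D"
  then show "C = D" using sub[of C D] sub[of D C] by auto
qed

lemma partition_on_Union_quotient:
  assumes P: "partition_on X P" and E: "equiv P E"
  shows "partition_on X (Union ` (P // E))"
proof (rule partition_onI)
  have Q: "partition_on P (P // E)" by (rule partition_on_quotient[OF E])
  show "\<Union> (Union ` (P // E)) = X"
    using partition_onD1[OF P] Union_quotient[OF E] by auto
  have "p \<noteq> {}" if "p \<in> Union ` (P // E)" for p
  proof -
    from that obtain C where C: "C \<in> P // E" "p = \<Union>C" by blast
    with Q obtain A where "A \<in> C" "A \<in> P" by (metis UnionI all_not_in_conv partition_onD1 partition_onD3)
    moreover from this P have "A \<noteq> {}" by (auto simp: partition_on_def)
    ultimately show ?thesis using C by blast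
  qed
  then show "{} \<notin> Union ` (P // E)" by blast
  show "disjnt p q" if pq: "p \<in> Union ` (P // E)" "q \<in> Union ` (P // E)" "p \<noteq> q" for p q
  proof -
    from pq obtain C D where CD: "C \<in> P // E" "p = \<Union>C" "D \<in> P // E" "q = \<Union>D" by blast
    with pq(3) have "C \<noteq> D" by blast
    with CD have "C \<inter> D = {}" using disjointD[OF partition_onD2[OF Q]] by blast
    moreover have "C \<subseteq> P" "D \<subseteq> P" using CD E by (auto dest: in_quotient_imp_subset)
    ultimately have "A \<inter> B = {}" if "A \<in> C" "B \<in> D" for A B
      using P that by (metis IntI disjointD empty_iff partition_onD2 subsetD)
    with CD show ?thesis by (auto simp: disjnt_def)
  qed
qed

lemma partition_on_Ret_pow: "partition_on X (fst (Ret_pow (X, r) m))"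
proof (induction m)
  case 0
  show ?case by (auto simp: fst_transport partition_on_def disjoint_def)
next
  case (Suc m)
  then show ?case
    by (simp add: fst_transport fst_Ret partition_on_Union_quotient equiv_ret_rel)
qed

lemma inj_on_Union_Ret_pow: "inj_on Union (fst (Ret (Ret_pow (X, r) m)))"
  unfolding fst_Ret by (rule inj_on_Union_quotient[OF partition_on_Ret_pow equiv_ret_rel])


text \<open>
  The induced map on the retraction of a nondegenerate symmetric set is well defined:
  \<open>ret_rel\<close> is a congruence. The map \<open>D\<close> below intertwines the right and the left actions.
\<close>

lemma Ret_apply:
  assumes sym: "symmetric_set X r" and nd: "nondegenerate X r" and "a \<in> X" "b \<in> X"
  shows "snd (Ret (X, r)) (ret_rel X r `` {a}, ret_rel X r `` {b}) =
           (ret_rel X r `` {lact r a b}, ret_rel X r `` {ract r a b})"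
proof -
  define L where "L = lact r"
  define R where "R = ract r"
  have r_eq: "r (x, y) = (L x y, R x y)" for x y by (simp add: L_def R_def lact_def ract_def)
  have cl: "L x y \<in> X" "R x y \<in> X" if "x \<in> X" "y \<in> X" for x y
    using nd that by (auto simp: nondegenerate_def L_def R_def dest: bij_betwE)
  have inv: "L (L x y) (R x y) = x" "R (L x y) (R x y) = y" if "x \<in> X" "y \<in> X" for x y
    using sym that by (auto simp: symmetric_set_def involutive_def r_eq)
  have Linj: "y = z" if "L x y = L x z" "x \<in> X" "y \<in> X" "z \<in> X" for x y z
    using nd that by (auto simp: nondegenerate_def L_def bij_betw_def dest: inj_onD)
  have Rinj: "x = z" if "R x y = R z y" "x \<in> X" "y \<in> X" "z \<in> X" for x y z
    using nd that by (auto simp: nondegenerate_def R_def bij_betw_def dest: inj_onD)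
  have Lsurj: "\<exists>y\<in>X. L x y = z" if "x \<in> X" "z \<in> X" for x z
    using nd that unfolding nondegenerate_def L_def bij_betw_def by (metis imageE)
  have Rsurj: "\<exists>x\<in>X. R x y = z" if "y \<in> X" "z \<in> X" for y z
    using nd that unfolding nondegenerate_def R_def bij_betw_def by (metis imageE)
  have yb: "L (L x y) (L (R x y) z) = L x (L y z)"
    "R (L x y) (L (R x y) z) = L (R x (L y z)) (R y z)"
    "R (R x y) z = R (R x (L y z)) (R y z)" if "x \<in> X" "y \<in> X" "z \<in> X" for x y z
  proof -
    have "on12 r (on23 r (on12 r (x, y, z))) = on23 r (on12 r (on23 r (x, y, z)))"
      using sym that by (auto simp: symmetric_set_def yang_baxter_def)
    then show "L (L x y) (L (R x y) z) = L x (L y z)"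
      "R (L x y) (L (R x y) z) = L (R x (L y z)) (R y z)"
      "R (R x y) z = R (R x (L y z)) (R y z)"
      by (simp_all add: on12_def on23_def r_eq)
  qed
  have rel: "(x, y) \<in> ret_rel X r \<longleftrightarrow> x \<in> X \<and> y \<in> X \<and> (\<forall>z\<in>X. L x z = L y z)" for x y
    by (auto simp: ret_rel_def L_def)
  have "\<forall>x\<in>X. \<exists>y\<in>X. L x y = x" using Lsurj by blast
  then obtain D where D: "\<And>x. x \<in> X \<Longrightarrow> D x \<in> X" "\<And>x. x \<in> X \<Longrightarrow> L x (D x) = x" by metis
  have RD: "R x (D x) = D x" if x: "x \<in> X" for x
  proof -
    have "L x (R x (D x)) = x" using inv(1)[of x "D x"] D x by simp
    then show ?thesis using Linj[of x "R x (D x)" "D x"] D cl x by simp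
  qed
  have Dinj: "x = y" if "D x = D y" "x \<in> X" "y \<in> X" for x y
    using Rinj[of x "D x" y] RD that D by metis
  have Dsurj: "\<exists>x\<in>X. D x = y" if y: "y \<in> X" for y
  proof -
    obtain w where w: "w \<in> X" "R w y = y" using Rsurj y by blast
    have "R (L w y) y = y" using inv(2)[of w y] w y by simp
    then have "L w y = w" using Rinj[of "L w y" y w] w y cl by simp
    then have "D w = y" using Linj[of w "D w" y] w y D by simp
    with w show ?thesis by blast
  qed
  have inter: "L y (D (R x y)) = D x" if x: "x \<in> X" and y: "y \<in> X" for x y
  proof -
    define u where "u = L x y"
    define v where "v = R x y"
    have uv: "u \<in> X" "v \<in> X" "L u v = x" "R u v = y" using cl inv x y by (auto simp: u_def v_def)
    have "L x (L y (D v)) = L u (L v (D v))"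
      using yb(1)[of u v "D v"] uv D by simp
    also have "\<dots> = x" using D uv by simp
    also have "\<dots> = L x (D x)" using D x by simp
    finally show ?thesis using Linj[of x "L y (D v)" "D x"] cl D x y uv by (simp add: v_def)
  qed
  have LR: "R z x = R z y" if "(x, y) \<in> ret_rel X r" "z \<in> X" for x y z
  proof -
    have xy: "x \<in> X" "y \<in> X" using that by (auto simp: rel)
    have "L x (D (R z x)) = L x (D (R z y))"
      using inter[of z x] inter[of z y] that xy D cl by (simp add: rel)
    then show ?thesis using Linj Dinj cl D xy that by metis
  qed
  have RL: "(x, y) \<in> ret_rel X r" if xy: "x \<in> X" "y \<in> X" and R: "\<And>z. z \<in> X \<Longrightarrow> R z x = R z y" for x y
  proof -
    have "L x w = L y w" if w: "w \<in> X" for w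
    proof -
      obtain v where v: "v \<in> X" "D v = w" using Dsurj w by blast
      obtain z where z: "z \<in> X" "R z x = v" using Rsurj xy v by blast
      show ?thesis using inter[of z x] inter[of z y] z v xy R by metis
    qed
    with xy show ?thesis by (simp add: rel)
  qed
  have congR: "(R x z, R y z) \<in> ret_rel X r" if xy: "(x, y) \<in> ret_rel X r" and z: "z \<in> X" for x y z
  proof (rule RL)
    have X: "x \<in> X" "y \<in> X" "L x z = L y z" using xy z by (auto simp: rel)
    show "R x z \<in> X" "R y z \<in> X" using X z cl by auto
    fix w assume w: "w \<in> X"
    obtain v where v: "v \<in> X" "R v (L x z) = w" using Rsurj[OF cl(1)[OF X(1) z] w] by blast
    have "R w (R x z) = R (R v x) z" using yb(3)[of v x z] v X z by simp
    also have "\<dots> = R (R v y) z" using LR[OF xy v(1)] by simp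
    also have "\<dots> = R w (R y z)" using yb(3)[of v y z] v X z by simp
    finally show "R w (R x z) = R w (R y z)" .
  qed
  have congL: "(L z x, L z y) \<in> ret_rel X r" if xy: "(x, y) \<in> ret_rel X r" and z: "z \<in> X" for x y z
  proof -
    have X: "x \<in> X" "y \<in> X" "R z x = R z y" using xy z LR by (auto simp: rel)
    have "L (L z x) w = L (L z y) w" if w: "w \<in> X" for w
    proof -
      obtain v where v: "v \<in> X" "L (R z x) v = w" using Lsurj[OF cl(2)[OF z X(1)] w] by blast
      have "L (L z x) w = L z (L x v)" using yb(1)[of z x v] v X z by simp
      also have "L x v = L y v" using xy v by (simp add: rel)
      also have "L z (L y v) = L (L z y) w" using yb(1)[of z y v] v X z by simp
      finally show ?thesis .
    qed
    then show ?thesis using cl(1)[OF z X(1)] cl(1)[OF z X(2)] by (simp add: rel)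
  qed
  let ?E = "ret_rel X r"
  define a' where "a' = (SOME x. x \<in> ?E `` {a})"
  define b' where "b' = (SOME x. x \<in> ?E `` {b})"
  have refl: "(x, x) \<in> ?E" if "x \<in> X" for x using that by (simp add: rel)
  have "a' \<in> ?E `` {a}" unfolding a'_def by (rule someI[of _ a]) (simp add: refl assms)
  then have a': "(a, a') \<in> ?E" by simp
  have "b' \<in> ?E `` {b}" unfolding b'_def by (rule someI[of _ b]) (simp add: refl assms)
  then have b': "(b, b') \<in> ?E" by simp
  have X: "a' \<in> X" "b' \<in> X" using a' b' by (auto simp: rel)
  have "(L a b, L a' b') \<in> ?E"
    using congL[OF b' X(1)] a' assms(4) by (simp add: rel)
  then have 1: "?E `` {L a' b'} = ?E `` {L a b}" by (metis equiv_class_eq equiv_ret_rel)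
  have "(R a b, R a' b') \<in> ?E"
    using congR[OF a' X(2)] LR[OF b' assms(3)] by simp
  then have 2: "?E `` {R a' b'} = ?E `` {R a b}" by (metis equiv_class_eq equiv_ret_rel)
  show ?thesis using 1 2 by (simp add: Ret_def Let_def a'_def b'_def L_def R_def)
qed

end

theory Submission
  imports Defs
begin

text \<open>
  The idea throughout is to express every condition through the permutations \<open>L\<^sub>x = lact r x\<close>.
  Evaluating \<open>r \<circ> f = f \<circ> \<tau>\<close> at \<open>(x, y)\<close> shows that \<open>r\<close> is the conjugate of the flip exactly when
  \<open>r (L\<^sub>x y, x) = (L\<^sub>y x, y)\<close> (\<open>flip_conjugate_iff\<close>). The second component of this equation is half of
  \<open>lri\<close>, the first one is one of the cyclic identities, and involutivity recovers each of the two
  components from the other.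

  For the second part, \<open>lri\<close> says that the right action of \<open>x\<close> is \<open>L\<^sub>x\<^sup>-\<^sup>1\<close>, so the right actions
  disappear. The Yang--Baxter equation for \<open>f\<close> becomes \<open>L\<^bsub>L\<^sub>x y\<^esub> L\<^sub>x = L\<^sub>x L\<^sub>y\<close>, while the first component of
  the one for \<open>r\<close> is \<open>L\<^bsub>L\<^sub>x y\<^esub> L\<^bsub>R\<^sub>y x\<^esub> = L\<^sub>x L\<^sub>y\<close>, where \<open>R\<^sub>y x = ract r x y\<close>. Comparing the two gives
  \<open>lact_ract_invariant\<close>. Conversely, under \<open>lact_ract_invariant\<close> either equation says
  that all \<open>L\<^sub>x\<close> commute, and commutation gives back both equations.

  For the third part, a retraction is a one-element set exactly when all left actions one level below
  coincide. Since the left action on classes is induced by \<open>r\<close>, level at most two means that the class of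
  \<open>L\<^sub>x y\<close> is independent of \<open>x\<close>; square-freeness (put \<open>x = y\<close>) turns this into
  \<open>L\<^bsub>L\<^sub>x y\<^esub> = L\<^sub>y\<close>. Together with involutivity, that is \<open>lri\<close> and \<open>lact_ract_invariant\<close>, and the second
  part applies.
\<close>

section \<open>The Yang--Baxter equations in terms of the two actions\<close>

lemma yang_baxter_assoc_map_iff:
  "yang_baxter X (assoc_map r) \<longleftrightarrow>
     (\<forall>x\<in>X. \<forall>y\<in>X. \<forall>z\<in>X. lact r (lact r x y) (lact r x z) = lact r x (lact r y z))"
  by (auto simp: yang_baxter_def on12_def on23_def assoc_map_def)

lemma yang_baxter_iff:
  "yang_baxter X r \<longleftrightarrow>
     (\<forall>x\<in>X. \<forall>y\<in>X. \<forall>z\<in>X.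
        lact r (lact r x y) (lact r (ract r x y) z) = lact r x (lact r y z) \<and>
        ract r (lact r x y) (lact r (ract r x y) z) = lact r (ract r x (lact r y z)) (ract r y z) \<and>
        ract r (ract r x y) z = ract r (ract r x (lact r y z)) (ract r y z))"
proof -
  have "r (x, y) = (lact r x y, ract r x y)" for x y by (simp add: lact_def ract_def)
  then show ?thesis by (auto simp: yang_baxter_def on12_def on23_def)
qed

lemma involutive_iff:
  "involutive X r \<longleftrightarrow>
     (\<forall>x\<in>X. \<forall>y\<in>X. lact r (lact r x y) (ract r x y) = x \<and> ract r (lact r x y) (ract r x y) = y)"
  by (auto simp: involutive_def lact_def ract_def prod_eq_iff)

section \<open>Conjugates of the flip\<close>

locale nondegenerate_quadratic_set =
  fixes X :: "'a set" and r :: "'a \<times> 'a \<Rightarrow> 'a \<times> 'a"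
  assumes quadratic: "quadratic_set X r" and nondeg: "nondegenerate X r"
begin

abbreviation L :: "'a \<Rightarrow> 'a \<Rightarrow> 'a" where "L \<equiv> lact r"
abbreviation R :: "'a \<Rightarrow> 'a \<Rightarrow> 'a" where "R \<equiv> ract r"

lemma nonempty: "X \<noteq> {}"
  using quadratic by (simp add: quadratic_set_def)

lemma bij_L: "x \<in> X \<Longrightarrow> bij_betw (L x) X X"
  using nondeg by (auto simp: nondegenerate_def)

lemma closed [simp]:
  assumes "x \<in> X" "y \<in> X"
  shows "L x y \<in> X" and "R x y \<in> X"
  using nondeg assms by (auto simp: nondegenerate_def dest: bij_betwE)

lemma L_inject: "x \<in> X \<Longrightarrow> y \<in> X \<Longrightarrow> z \<in> X \<Longrightarrow> L x y = L x z \<longleftrightarrow> y = z"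
  using bij_L by (auto simp: bij_betw_def dest: inj_onD)

lemma L_surj:
  assumes "x \<in> X" "z \<in> X"
  obtains y where "y \<in> X" "L x y = z"
  using bij_L[OF assms(1)] assms(2) unfolding bij_betw_def by (metis imageE)

lemma bij_assoc_map: "bij_betw (assoc_map r) (X \<times> X) (X \<times> X)"
  unfolding bij_betw_def
proof
  show "inj_on (assoc_map r) (X \<times> X)"
    by (auto simp: inj_on_def assoc_map_def L_inject)
  show "assoc_map r ` (X \<times> X) = X \<times> X"
  proof
    show "X \<times> X \<subseteq> assoc_map r ` (X \<times> X)"
    proof clarify
      fix a x assume ax: "a \<in> X" "x \<in> X"
      obtain y where "y \<in> X" "L x y = a" using L_surj[OF ax(2,1)] .
      with ax show "(a, x) \<in> assoc_map r ` (X \<times> X)"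
        by (auto simp: assoc_map_def intro!: image_eqI[of _ _ "(x, y)"])
    qed
  qed (auto simp: assoc_map_def)
qed

lemma quadratic_set_assoc_map: "quadratic_set X (assoc_map r)"
  using bij_assoc_map nonempty by (simp add: quadratic_set_def)

lemma nondegenerate_assoc_map: "nondegenerate X (assoc_map r)"
proof -
  have "lact (assoc_map r) x y = L x y" "ract (assoc_map r) x y = x" for x y
    by (simp_all add: lact_def[of "assoc_map r"] ract_def[of "assoc_map r"])
       (simp_all add: assoc_map_def)
  moreover have "bij_betw (\<lambda>x. x) X X" by (simp add: bij_betw_def)
  ultimately show ?thesis by (simp add: nondegenerate_def bij_L)
qed

text \<open>
  Since \<open>f\<close> is a bijection, \<open>r = f \<circ> \<tau> \<circ> f\<^sup>-\<^sup>1\<close> is the same as \<open>r \<circ> f = f \<circ> \<tau>\<close>, which no longer mentions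
  the inverse.
\<close>

lemma flip_conjugate_iff:
  "flip_conjugate X r \<longleftrightarrow> (\<forall>x\<in>X. \<forall>y\<in>X. L (L x y) x = L y x \<and> R (L x y) x = y)"
proof -
  let ?f = "assoc_map r"
  have inv: "inv_into (X \<times> X) ?f (?f q) = q" if "q \<in> X \<times> X" for q
    using that bij_assoc_map by (simp add: bij_betw_def)
  have "flip_conjugate X r \<longleftrightarrow>
      (\<forall>p\<in>?f ` (X \<times> X). r p = (?f \<circ> prod.swap \<circ> inv_into (X \<times> X) ?f) p)"
    using bij_assoc_map by (simp add: flip_conjugate_def bij_betw_def)
  also have "\<dots> \<longleftrightarrow> (\<forall>q\<in>X \<times> X. r (?f q) = ?f (prod.swap q))"
    by (simp only: ball_simps comp_apply inv cong: ball_cong)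
  also have "\<dots> \<longleftrightarrow> (\<forall>x\<in>X. \<forall>y\<in>X. r (L x y, x) = (L y x, y))"
    by (auto simp: assoc_map_def)
  also have "\<dots> \<longleftrightarrow> (\<forall>x\<in>X. \<forall>y\<in>X. L (L x y) x = L y x \<and> R (L x y) x = y)"
    by (simp add: prod_eq_iff lact_def[of r "L _ _"] ract_def)
  finally show ?thesis .
qed

text \<open>As \<open>L\<^sub>x\<close> is a permutation, a one-sided inverse is an inverse.\<close>

lemma lri_left_iff: "lri X r \<longleftrightarrow> (\<forall>x\<in>X. \<forall>y\<in>X. R (L x y) x = y)"
proof
  assume h: "\<forall>x\<in>X. \<forall>y\<in>X. R (L x y) x = y"
  have "L x (R y x) = y" if xy: "x \<in> X" "y \<in> X" for x y
  proof -
    obtain z where "z \<in> X" "L x z = y" using L_surj[OF xy] .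
    with h xy show ?thesis by metis
  qed
  with h show "lri X r" by (simp add: lri_def)
qed (auto simp: lri_def)

lemma lri_right_iff: "lri X r \<longleftrightarrow> (\<forall>x\<in>X. \<forall>y\<in>X. L x (R y x) = y)"
proof
  assume h: "\<forall>x\<in>X. \<forall>y\<in>X. L x (R y x) = y"
  have "R (L x y) x = y" if xy: "x \<in> X" "y \<in> X" for x y
  proof -
    have "L x (R (L x y) x) = L x y" using h xy by simp
    with xy show ?thesis by (simp add: L_inject)
  qed
  then show "lri X r" by (simp add: lri_left_iff)
qed (auto simp: lri_def)

lemma lriD:
  assumes "lri X r" "x \<in> X" "y \<in> X"
  shows "R (L x y) x = y" and "L x (R y x) = y"
  using assms by (auto simp: lri_def)

lemma flip_conjugate_imp_involutive:
  assumes fc: "flip_conjugate X r"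
  shows "involutive X r"
  unfolding involutive_iff
proof (intro ballI)
  fix a x assume ax: "a \<in> X" "x \<in> X"
  \<comment> \<open>Every pair has the form \<open>f (x, y)\<close>, and applying \<open>r\<close> to it exchanges \<open>x\<close> and \<open>y\<close>.\<close>
  obtain y where "y \<in> X" "L x y = a" using L_surj[OF ax(2,1)] .
  with fc ax show "L (L a x) (R a x) = a \<and> R (L a x) (R a x) = x"
    unfolding flip_conjugate_iff by metis
qed

lemma flip_conjugate_imp_lri: "flip_conjugate X r \<Longrightarrow> lri X r"
  by (simp add: flip_conjugate_iff lri_left_iff)

text \<open>
  For the left action, \<open>L\<^bsub>L\<^sub>x y\<^esub> x = L\<^sub>y x\<close> is the first component of \<open>flip_conjugate_iff\<close>. For the right
  action, which inverts the left one, involutivity in the form \<open>L\<^bsub>L\<^sub>x y\<^esub> (R\<^sub>y x) = x\<close> gives the analogous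
  identity. The other two follow by replacing \<open>y\<close> by \<open>L\<^sub>x\<^sup>-\<^sup>1 y\<close>.
\<close>

lemma flip_conjugate_imp_cyclic:
  assumes fc: "flip_conjugate X r"
  shows "cyclic X r"
proof -
  note lri = lriD[OF flip_conjugate_imp_lri[OF fc]]
  have LL: "L (L x y) x = L y x" if "x \<in> X" "y \<in> X" for x y
    using fc that by (simp add: flip_conjugate_iff)
  have LR: "L (R y x) x = L y x" if "x \<in> X" "y \<in> X" for x y
    using LL[of x "R y x"] lri that by simp
  have RL: "R x (L x y) = R x y" if xy: "x \<in> X" "y \<in> X" for x y
  proof -
    have "L (L x y) (R x y) = x"
      using flip_conjugate_imp_involutive[OF fc] xy by (simp add: involutive_iff)
    then show ?thesis using lri(1)[of "L x y" "R x y"] xy by simp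
  qed
  have RR: "R x (R y x) = R x y" if "x \<in> X" "y \<in> X" for x y
    using RL[of x "R y x"] lri that by simp
  from LL LR RL RR show ?thesis by (simp add: cyclic_def)
qed

lemma involutive_lri_imp_flip_conjugate:
  assumes inv: "involutive X r" and lri: "lri X r"
  shows "flip_conjugate X r"
  unfolding flip_conjugate_iff
proof (intro ballI conjI)
  fix x y assume xy: "x \<in> X" "y \<in> X"
  show y: "R (L x y) x = y" using lriD[OF lri] xy by simp
  have "R (L (L x y) x) (R (L x y) x) = x" using inv xy by (simp add: involutive_iff)
  then show "L (L x y) x = L y x"
    using lriD(2)[OF lri, of y "L (L x y) x"] xy y by simp
qed

lemma involutive_cyclic_imp_flip_conjugate:
  assumes inv: "involutive X r" and cyc: "cyclic X r"
  shows "flip_conjugate X r"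
  unfolding flip_conjugate_iff
proof (intro ballI conjI)
  have LL: "L (L x y) x = L y x" if "x \<in> X" "y \<in> X" for x y
    using cyc that by (auto simp: cyclic_def)
  fix x y assume xy: "x \<in> X" "y \<in> X"
  show "L (L x y) x = L y x" using LL xy .
  have "L (L (L x y) x) (R (L x y) x) = L x y" using inv xy by (simp add: involutive_iff)
  then have "L (L y x) (R (L x y) x) = L (L y x) y" using LL xy by simp
  then show "R (L x y) x = y" using xy by (simp add: L_inject)
qed

section \<open>Two of the three conditions\<close>

lemma lact_ract_invariantD:
  "lact_ract_invariant X r \<Longrightarrow> x \<in> X \<Longrightarrow> y \<in> X \<Longrightarrow> z \<in> X \<Longrightarrow> L (R x y) z = L x z"
  by (simp add: lact_ract_invariant_def)

lemma lact_ract_invariant_imp_lact_lact: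
  assumes "lri X r" "lact_ract_invariant X r" "x \<in> X" "y \<in> X" "z \<in> X"
  shows "L (L x y) z = L y z"
  using lact_ract_invariantD[OF assms(2), of "L x y" x z] lriD[OF assms(1)] assms by simp

context
  assumes lri: "lri X r" and invar: "lact_ract_invariant X r"
begin

lemma yang_baxter_assoc_map_iff_commute:
  "yang_baxter X (assoc_map r) \<longleftrightarrow> (\<forall>x\<in>X. \<forall>y\<in>X. \<forall>z\<in>X. L y (L x z) = L x (L y z))"
  using lact_ract_invariant_imp_lact_lact[OF lri invar] by (simp add: yang_baxter_assoc_map_iff)

text \<open>
  The first component of the Yang--Baxter equation becomes commutation after rewriting
  \<open>L\<^bsub>L\<^sub>x y\<^esub> = L\<^sub>y\<close> and \<open>L\<^bsub>R\<^sub>y x\<^esub> = L\<^sub>x\<close>. The other two compare elements that involve right actions; both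
  are checked after applying left actions that cancel all right ones.
\<close>

lemma yang_baxter_iff_commute:
  "yang_baxter X r \<longleftrightarrow> (\<forall>x\<in>X. \<forall>y\<in>X. \<forall>z\<in>X. L y (L x z) = L x (L y z))"
proof
  note LL = lact_ract_invariant_imp_lact_lact[OF lri invar]
  note LR = lact_ract_invariantD[OF invar]
  note can = lriD[OF lri]
  show "\<forall>x\<in>X. \<forall>y\<in>X. \<forall>z\<in>X. L y (L x z) = L x (L y z)" if "yang_baxter X r"
    using that LL LR by (simp add: yang_baxter_iff)
  assume "\<forall>x\<in>X. \<forall>y\<in>X. \<forall>z\<in>X. L y (L x z) = L x (L y z)"
  then have comm: "L y (L x z) = L x (L y z)" if "x \<in> X" "y \<in> X" "z \<in> X" for x y z
    using that by blast
  show "yang_baxter X r"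
    unfolding yang_baxter_iff
  proof (intro ballI conjI)
    fix x y z assume X: "x \<in> X" "y \<in> X" "z \<in> X"
    show "L (L x y) (L (R x y) z) = L x (L y z)"
      using X LL LR comm by simp
    have "L (L x z) (L (R x (L y z)) (R y z)) = L z (L x (R y z))"
      using X LL LR by simp
    also have "\<dots> = L x (L z (R y z))" using X by (simp add: comm)
    also have "\<dots> = L (L x z) (R (L x y) (L x z))" using X by (simp add: can)
    finally show "R (L x y) (L (R x y) z) = L (R x (L y z)) (R y z)"
      using X by (simp add: L_inject LR)
    let ?w = "R x (L y z)"
    have "L y (L z (R (R x y) z)) = x" using X by (simp add: can)
    also have "x = L (L y z) ?w" using X by (simp add: can)
    also have "\<dots> = L z ?w" using X by (simp add: LL)
    also have "\<dots> = L z (L (R y z) (R ?w (R y z)))" using X by (simp add: can)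
    also have "\<dots> = L z (L y (R ?w (R y z)))" using X by (simp add: LR)
    also have "\<dots> = L y (L z (R ?w (R y z)))" using X by (simp add: comm[of z y])
    finally show "R (R x y) z = R ?w (R y z)" using X by (simp add: L_inject)
  qed
qed

text \<open>
  Here \<open>L\<^bsub>L\<^sub>x y\<^esub> = L\<^sub>y\<close> holds outright, so the first component of \<open>flip_conjugate_iff\<close> is immediate; its
  second component is half of \<open>lri\<close>.
\<close>

lemma lri_lact_ract_invariant_imp_flip_conjugate: "flip_conjugate X r"
  using lact_ract_invariant_imp_lact_lact[OF lri invar] lriD[OF lri]
  by (simp add: flip_conjugate_iff)

end

text \<open>
  Both equations express \<open>L\<^sub>x L\<^sub>y\<close> as \<open>L\<^bsub>L\<^sub>x y\<^esub>\<close> times another left action, and \<open>L\<^bsub>L\<^sub>x y\<^esub>\<close> cancels.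
\<close>

lemma both_yang_baxter_imp_lact_ract_invariant:
  assumes "yang_baxter X (assoc_map r)" "yang_baxter X r"
  shows "lact_ract_invariant X r"
  unfolding lact_ract_invariant_def
proof (intro ballI)
  fix x y z assume X: "x \<in> X" "y \<in> X" "z \<in> X"
  have "L (L x y) (L (R x y) z) = L (L x y) (L x z)"
    using assms(1)[unfolded yang_baxter_assoc_map_iff] assms(2)[unfolded yang_baxter_iff] X by simp
  then show "L (R x y) z = L x z" using X by (simp add: L_inject)
qed

end

section \<open>Retractions\<close>

text \<open>
  Passing to unions of fibres is injective, so it does not affect whether there is only one class.
\<close>

lemma is_singleton_Ret_pow_Suc:
  fixes X :: "'a set" and r :: "'a \<times> 'a \<Rightarrow> 'a \<times> 'a"
  assumes ne: "X \<noteq> {}"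
  defines "P \<equiv> \<lambda>m. fst (Ret_pow (X, r) m)" and "s \<equiv> \<lambda>m. snd (Ret_pow (X, r) m)"
  shows "is_singleton (P (Suc m)) \<longleftrightarrow>
    (\<forall>A\<in>P m. \<forall>B\<in>P m. \<forall>C\<in>P m. lact (s m) A C = lact (s m) B C)"
proof -
  let ?E = "ret_rel (P m) (s m)"
  have P_ne: "P m \<noteq> {}"
    using partition_on_Ret_pow[of X r m] ne by (auto simp: P_def partition_on_def)
  have P_Suc: "P (Suc m) = Union ` (P m // ?E)"
    by (simp add: P_def s_def fst_transport fst_Ret)
  have inj: "inj_on Union (P m // ?E)"
    using inj_on_Union_Ret_pow[of X r m] by (simp add: P_def s_def fst_Ret)
  have "is_singleton (P (Suc m)) \<longleftrightarrow> is_singleton (P m // ?E)"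
    using inj by (simp add: P_Suc is_singleton_altdef card_image)
  also have "\<dots> \<longleftrightarrow> (\<forall>A\<in>P m. \<forall>B\<in>P m. (A, B) \<in> ?E)"
  proof
    assume "is_singleton (P m // ?E)"
    then obtain c where "P m // ?E = {c}" by (rule is_singletonE)
    then have "?E `` {A} = c" if "A \<in> P m" for A using quotientI[OF that, of ?E] by simp
    then show "\<forall>A\<in>P m. \<forall>B\<in>P m. (A, B) \<in> ?E"
      by (auto intro: eq_equiv_class[OF _ equiv_ret_rel])
  next
    assume h: "\<forall>A\<in>P m. \<forall>B\<in>P m. (A, B) \<in> ?E"
    from P_ne obtain A where A: "A \<in> P m" by blast
    have "P m // ?E = {?E `` {A}}"
    proof
      have "?E `` {B} = ?E `` {A}" if "B \<in> P m" for B
        using h A that by (intro equiv_class_eq[OF equiv_ret_rel]) blast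
      then show "P m // ?E \<subseteq> {?E `` {A}}" by (auto simp: quotient_def)
    qed (use A in \<open>simp add: quotientI\<close>)
    then show "is_singleton (P m // ?E)" by (simp add: is_singleton_def)
  qed
  also have "\<dots> \<longleftrightarrow> (\<forall>A\<in>P m. \<forall>B\<in>P m. \<forall>C\<in>P m. lact (s m) A C = lact (s m) B C)"
    by (auto simp: ret_rel_def)
  finally show ?thesis .
qed

lemma multipermutation_level_le_iff:
  assumes "X \<noteq> {}"
  shows "(\<exists>m\<le>n. has_multipermutation_level X r m) \<longleftrightarrow> is_singleton (fst (Ret_pow (X, r) n))"
proof
  assume "\<exists>m\<le>n. has_multipermutation_level X r m"
  then obtain m where m: "m \<le> n" "is_singleton (fst (Ret_pow (X, r) m))"
    by (auto simp: has_multipermutation_level_def)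
  show "is_singleton (fst (Ret_pow (X, r) n))"
    using m
  proof (induction n rule: dec_induct)
    case (step n)
    then show ?case
      by (subst is_singleton_Ret_pow_Suc[OF assms]) (metis is_singletonE singletonD)
  qed simp
next
  let ?P = "\<lambda>m. is_singleton (fst (Ret_pow (X, r) m))"
  assume "?P n"
  then have "(LEAST m. ?P m) \<le> n" "has_multipermutation_level X r (LEAST m. ?P m)"
    by (auto simp: has_multipermutation_level_def intro: Least_le LeastI dest: not_less_Least)
  then show "\<exists>m\<le>n. has_multipermutation_level X r m" by blast
qed

lemma snd_transport_apply:
  assumes "inj_on h X" "x \<in> X" "y \<in> X"
  shows "snd (transport h (X, r)) (h x, h y) = map_prod h h (r (x, y))"
  using assms by (simp add: transport_def)

context nondegenerate_quadratic_set
begin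

text \<open>
  The iterated retractions start from the set of singletons; this allows \<open>Ret_apply\<close> to be used there.
\<close>

lemma transport_structure:
  assumes inj: "inj_on h X"
  defines "s \<equiv> snd (transport h (X, r))"
  assumes sym: "symmetric_set X r"
  shows "symmetric_set (h ` X) s" and "nondegenerate (h ` X) s"
proof -
  have s: "s (h x, h y) = (h (L x y), h (R x y))" if "x \<in> X" "y \<in> X" for x y
    using snd_transport_apply[OF inj that, of r]
    by (simp add: s_def map_prod_def lact_def ract_def split: prod.split)
  have ls: "lact s (h x) (h y) = h (L x y)" "ract s (h x) (h y) = h (R x y)"
    if "x \<in> X" "y \<in> X" for x y
    using s[OF that] by (simp_all add: lact_def[of s] ract_def[of s])
  have inv: "involutive (h ` X) s"
    using sym by (simp add: symmetric_set_def involutive_iff ls)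
  have yb: "yang_baxter (h ` X) s"
    unfolding yang_baxter_iff
  proof (intro ballI; elim imageE; hypsubst)
    fix x y z assume X: "x \<in> X" "y \<in> X" "z \<in> X"
    have "L (L x y) (L (R x y) z) = L x (L y z) \<and>
        R (L x y) (L (R x y) z) = L (R x (L y z)) (R y z) \<and>
        R (R x y) z = R (R x (L y z)) (R y z)"
      using sym X by (simp only: symmetric_set_def yang_baxter_iff)
    then show "lact s (lact s (h x) (h y)) (lact s (ract s (h x) (h y)) (h z))
          = lact s (h x) (lact s (h y) (h z)) \<and>
        ract s (lact s (h x) (h y)) (lact s (ract s (h x) (h y)) (h z))
          = lact s (ract s (h x) (lact s (h y) (h z))) (ract s (h y) (h z)) \<and>
        ract s (ract s (h x) (h y)) (h z)
          = ract s (ract s (h x) (lact s (h y) (h z))) (ract s (h y) (h z))"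
      by (simp add: X ls)
  qed
  have closed_s: "s p \<in> h ` X \<times> h ` X" if "p \<in> h ` X \<times> h ` X" for p
    using that s by auto
  have "bij_betw s (h ` X \<times> h ` X) (h ` X \<times> h ` X)"
    using inv closed_s
    by (intro bij_betw_byWitness[where f' = s] image_subsetI) (simp_all only: involutive_def)
  with inv yb nonempty show "symmetric_set (h ` X) s"
    by (simp add: symmetric_set_def quadratic_set_def)
  have h: "bij_betw h X (h ` X)" using inj by (simp add: bij_betw_def)
  have conj: "bij_betw g (h ` X) (h ` X)"
    if "bij_betw k X X" "\<And>x. x \<in> X \<Longrightarrow> g (h x) = h (k x)" for g k
  proof -
    have "bij_betw (h \<circ> k) X (h ` X)" using bij_betw_trans[OF that(1) h] .
    then have "bij_betw (g \<circ> h) X (h ` X)" using that(2) by (simp cong: bij_betw_cong)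
    then show ?thesis using bij_betw_comp_iff[OF h] by blast
  qed
  show "nondegenerate (h ` X) s"
    unfolding nondegenerate_def
  proof (intro conjI ballI; elim imageE; hypsubst)
    fix x assume x: "x \<in> X"
    show "bij_betw (lact s (h x)) (h ` X) (h ` X)"
      by (rule conj[OF bij_L[OF x]]) (simp add: ls x)
    show "bij_betw (\<lambda>y. ract s y (h x)) (h ` X) (h ` X)"
      by (rule conj[where k = "\<lambda>y. R y x"]) (use nondeg x in \<open>simp_all add: ls nondegenerate_def\<close>)
  qed
qed

text \<open>
  The fibres of the first retraction are the classes of \<open>ret_rel X r\<close>, and the left action on them is the
  one induced by \<open>r\<close>. Computing one such step is enough: the second retraction matters only through its
  number of elements.
\<close>

lemma first_retraction:
  assumes sym: "symmetric_set X r"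
  shows "fst (Ret_pow (X, r) 1) = (\<lambda>x. ret_rel X r `` {x}) ` X"
    and "a \<in> X \<Longrightarrow> b \<in> X \<Longrightarrow> lact (snd (Ret_pow (X, r) 1)) (ret_rel X r `` {a}) (ret_rel X r `` {b})
      = ret_rel X r `` {L a b}"
proof -
  let ?h = "\<lambda>x. {x}"
  define Y where "Y = ?h ` X"
  define s where "s = snd (transport ?h (X, r))"
  have Q0: "Ret_pow (X, r) 0 = (Y, s)"
    by (simp add: prod_eq_iff fst_transport Y_def s_def)
  have inj: "inj_on ?h X" by simp
  have ls: "lact s {x} {y} = {L x y}" if "x \<in> X" "y \<in> X" for x y
    using snd_transport_apply[OF inj that, of r]
    by (simp add: s_def lact_def)
  have Y: "symmetric_set Y s" "nondegenerate Y s"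
    using transport_structure[OF inj sym] by (simp_all add: Y_def s_def)
  have E: "\<Union> (ret_rel Y s `` {{x}}) = ret_rel X r `` {x}" if "x \<in> X" for x
    using that by (auto simp: ret_rel_def Y_def ls)
  have "fst (Ret_pow (X, r) (Suc 0)) = Union ` (Y // ret_rel Y s)"
    unfolding Ret_pow.simps(2) Q0 by (simp add: fst_transport fst_Ret)
  also have "\<dots> = (\<lambda>x. ret_rel X r `` {x}) ` X"
    by (simp add: proj_image[symmetric] proj_def Y_def[symmetric] image_image)
       (simp add: Y_def image_image E[unfolded Y_def] cong: image_cong)
  finally show "fst (Ret_pow (X, r) 1) = (\<lambda>x. ret_rel X r `` {x}) ` X" by simp
  assume ab: "a \<in> X" "b \<in> X"
  let ?c = "\<lambda>x. ret_rel Y s `` {{x}}"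
  have c: "?c x \<in> fst (Ret (Y, s))" if "x \<in> X" for x
    using that by (auto simp: fst_Ret Y_def intro!: quotientI)
  have injU: "inj_on Union (fst (Ret (Y, s)))"
    using inj_on_Union_Ret_pow[of X r 0] unfolding Q0 .
  have "snd (Ret_pow (X, r) 1) (ret_rel X r `` {a}, ret_rel X r `` {b})
      = snd (transport Union (Ret (Y, s))) (\<Union>(?c a), \<Union>(?c b))"
    using ab unfolding One_nat_def Ret_pow.simps(2) Q0 by (simp add: E)
  also have "\<dots> = map_prod Union Union (snd (Ret (Y, s)) (?c a, ?c b))"
    using snd_transport_apply[OF injU c c, OF ab, of "snd (Ret (Y, s))"] by simp
  also have "snd (Ret (Y, s)) (?c a, ?c b)
      = (ret_rel Y s `` {lact s {a} {b}}, ret_rel Y s `` {ract s {a} {b}})"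
    using Ret_apply[OF Y] ab by (simp add: Y_def)
  finally show "lact (snd (Ret_pow (X, r) 1)) (ret_rel X r `` {a}) (ret_rel X r `` {b})
      = ret_rel X r `` {L a b}"
    using ab by (simp add: lact_def[of "snd (Ret_pow (X, r) 1)"] ls E del: Ret_pow.simps One_nat_def)
qed

lemma multipermutation_level_le_2_iff:
  assumes sym: "symmetric_set X r"
  shows "(\<exists>m\<le>2. has_multipermutation_level X r m) \<longleftrightarrow>
    (\<forall>x\<in>X. \<forall>y\<in>X. \<forall>z\<in>X. \<forall>w\<in>X. L (L x z) w = L (L y z) w)"
proof -
  have "(\<exists>m\<le>2. has_multipermutation_level X r m) \<longleftrightarrow>
      is_singleton (fst (Ret_pow (X, r) (Suc 1)))"
    using multipermutation_level_le_iff[OF nonempty, of 2] by (simp add: numeral_2_eq_2)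
  also have "\<dots> \<longleftrightarrow> (\<forall>x\<in>X. \<forall>y\<in>X. \<forall>z\<in>X. ret_rel X r `` {L x z} = ret_rel X r `` {L y z})"
    unfolding is_singleton_Ret_pow_Suc[OF nonempty] first_retraction(1)[OF sym]
    by (simp add: first_retraction(2)[OF sym, simplified])
  also have "\<dots> \<longleftrightarrow> (\<forall>x\<in>X. \<forall>y\<in>X. \<forall>z\<in>X. (L x z, L y z) \<in> ret_rel X r)"
    by (simp add: eq_equiv_class_iff[OF equiv_ret_rel])
  finally show ?thesis by (simp add: ret_rel_def)
qed

lemma square_free_level_le_2_iff:
  assumes sym: "symmetric_set X r" and sf: "square_free X r"
  shows "(\<exists>m\<le>2. has_multipermutation_level X r m) \<longleftrightarrow>
    (\<forall>x\<in>X. \<forall>y\<in>X. \<forall>z\<in>X. L (L x y) z = L y z)"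
proof -
  have "L y y = y" if "y \<in> X" for y
    using sf that by (simp add: square_free_def lact_def)
  then show ?thesis
    unfolding multipermutation_level_le_2_iff[OF sym] by metis
qed

text \<open>
  If \<open>L\<^bsub>L\<^sub>x y\<^esub> = L\<^sub>y\<close>, the involutivity relation \<open>L\<^bsub>L\<^sub>x y\<^esub> (R\<^sub>y x) = x\<close> reads \<open>L\<^sub>y (R\<^sub>y x) = x\<close>, which is
  \<open>lri\<close>; and substituting \<open>x = L\<^bsub>L\<^sub>x y\<^esub> (R\<^sub>y x)\<close> into \<open>L\<^sub>x\<close> gives the invariance.
\<close>

lemma involutive_lact_lact_imp:
  assumes inv: "involutive X r"
    and LL: "\<forall>x\<in>X. \<forall>y\<in>X. \<forall>z\<in>X. L (L x y) z = L y z"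
  shows "lri X r" and "lact_ract_invariant X r"
proof -
  have x: "L (L x y) (R x y) = x" if "x \<in> X" "y \<in> X" for x y
    using inv that by (simp add: involutive_iff)
  show "lri X r"
    unfolding lri_right_iff using x LL by simp
  show "lact_ract_invariant X r"
    unfolding lact_ract_invariant_def
  proof (intro ballI)
    fix x y z assume X: "x \<in> X" "y \<in> X" "z \<in> X"
    have "L (L (L x y) (R x y)) z = L (R x y) z" using LL X by (meson closed)
    then show "L (R x y) z = L x z" using x X by simp
  qed
qed

end

section \<open>The three equivalences\<close>

theorem proposition7p1:
  fixes X :: "'a set" and r :: "'a \<times> 'a \<Rightarrow> 'a \<times> 'a"
  assumes "quadratic_set X r" and "nondegenerate X r"
  shows
    "(quadratic_set X (assoc_map r) \<and> nondegenerate X (assoc_map r)) \<and>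
     ((flip_conjugate X r \<longleftrightarrow> involutive X r \<and> lri X r) \<and>
      (flip_conjugate X r \<longleftrightarrow> involutive X r \<and> cyclic X r)) \<and>
     (lri X r \<longrightarrow>
       (lact_ract_invariant X r \<and> yang_baxter X (assoc_map r)
          \<longrightarrow> yang_baxter X r \<and> flip_conjugate X r) \<and>
       (lact_ract_invariant X r \<and> yang_baxter X r
          \<longrightarrow> yang_baxter X (assoc_map r) \<and> flip_conjugate X r) \<and>
       (yang_baxter X (assoc_map r) \<and> yang_baxter X r
          \<longrightarrow> lact_ract_invariant X r \<and> flip_conjugate X r)) \<and>
     (square_free X r \<longrightarrow>
       ((lri X r \<and> flip_conjugate X r \<and> lact_ract_invariant X r \<and>
         yang_baxter X (assoc_map r) \<and> yang_baxter X r)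
        \<longleftrightarrow> symmetric_set X r \<and> (\<exists>m\<le>2. has_multipermutation_level X r m)))"
proof -
  interpret nondegenerate_quadratic_set X r using assms by unfold_locales
  have part1: "flip_conjugate X r \<longleftrightarrow> involutive X r \<and> lri X r"
    "flip_conjugate X r \<longleftrightarrow> involutive X r \<and> cyclic X r"
    using flip_conjugate_imp_involutive flip_conjugate_imp_lri flip_conjugate_imp_cyclic
      involutive_lri_imp_flip_conjugate involutive_cyclic_imp_flip_conjugate by blast+
  have f_iff_r: "yang_baxter X (assoc_map r) \<longleftrightarrow> yang_baxter X r"
    if "lri X r" "lact_ract_invariant X r"
    using yang_baxter_assoc_map_iff_commute[OF that] yang_baxter_iff_commute[OF that] by simp
  have part3: "(lri X r \<and> flip_conjugate X r \<and> lact_ract_invariant X r \<and>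
         yang_baxter X (assoc_map r) \<and> yang_baxter X r)
        \<longleftrightarrow> symmetric_set X r \<and> (\<exists>m\<le>2. has_multipermutation_level X r m)"
    if sf: "square_free X r"
  proof
    assume h: "lri X r \<and> flip_conjugate X r \<and> lact_ract_invariant X r \<and>
         yang_baxter X (assoc_map r) \<and> yang_baxter X r"
    then have sym: "symmetric_set X r"
      by (simp add: symmetric_set_def quadratic part1(1))
    moreover have "\<forall>x\<in>X. \<forall>y\<in>X. \<forall>z\<in>X. L (L x y) z = L y z"
      using h lact_ract_invariant_imp_lact_lact by blast
    ultimately show "symmetric_set X r \<and> (\<exists>m\<le>2. has_multipermutation_level X r m)"
      using square_free_level_le_2_iff[OF sym sf] by simp
  next
    assume h: "symmetric_set X r \<and> (\<exists>m\<le>2. has_multipermutation_level X r m)"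
    then have inv: "involutive X r" and yb: "yang_baxter X r"
      and LL: "\<forall>x\<in>X. \<forall>y\<in>X. \<forall>z\<in>X. L (L x y) z = L y z"
      using square_free_level_le_2_iff[OF _ sf] by (auto simp: symmetric_set_def)
    note lri = involutive_lact_lact_imp[OF inv LL]
    with inv yb show "lri X r \<and> flip_conjugate X r \<and> lact_ract_invariant X r \<and>
         yang_baxter X (assoc_map r) \<and> yang_baxter X r"
      by (simp add: part1(1) f_iff_r)
  qed
  show ?thesis
    using quadratic_set_assoc_map nondegenerate_assoc_map part1 f_iff_r part3
      lri_lact_ract_invariant_imp_flip_conjugate both_yang_baxter_imp_lact_ract_invariant
    by blast
qed

end
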